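(* Let $X$ be real-valued and, for every $\theta\in\Theta$, symmetric about $0$ given $\theta$. For $\alpha\in\mathbb{R}\setminus\{0\}$ let $h_\alpha$ be the skewing distortion function $$h_\alpha(y)=\int_{-\infty}^{F_X^{-1}(y|\theta)}2f_X(x|\theta)F_X(\alpha x|\theta)\,d\lambda(x),\qquad y\in[0,1],$$ (and $h_0(y)=y$, $\alpha_0=0$), applied to $F_X$ (likelihood distortion only). Assume that for $\Pi$-almost every $\theta$ the maps $\alpha\mapsto\log h'_\alpha(F_X(x_i|\theta))$, $i=1,\dots,n$, are differentiable at $\alpha_0=0$. Let $\delta_0>0$, let $g:\Theta\to\mathbb{R}^s$ be measurable, and assume that for some $G\in L^1(\Pi)$, $\left|\delta^{-1}g(\theta)(\mathcal{L}_{h_{\delta}}(\theta)-\mathcal{L}_{h_0}(\theta))\right|\le G(\theta)$ for all $0<|\delta|\le\delta_0$ and $\Pi$-almost every $\theta$. Then the Bayesian local sensitivity $\delta_n^{h_\alpha}=\frac{\partial}{\partial\alpha}\mathrm{E}_{\Pi^n_{h_\alpha}}[g(\vartheta)]\big|_{\alpha=0}$ satisfies $$\delta_n^{h_\alpha}=\mathrm{Cov}_{\Pi^n}\Big[g(\vartheta),\ 2f_X(0|\vartheta)\sum_{i=1}^n x_i\Big].$$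
   Context: Setting: $\Theta\subseteq\mathbb{R}^k$ is the parameter space with prior probability distribution $\Pi$; $\vartheta$ is the random parameter with law $\Pi$. Given $\theta\in\Theta$, $X$ has distribution function $F_X(\cdot|\theta)$ and density $f_X(\cdot|\theta)=\partial F_X(\cdot|\theta)/\partial x$; $\lambda$ is Lebesgue measure. The sample $x_{1:n}=(x_1,\dots,x_n)$ is a fixed realisation of an i.i.d. sample of $X$. The likelihood is $\mathcal{L}(\theta)=\prod_{i=1}^n f_X(x_i|\theta)$, and $\Pi^n$ is the posterior, $d\Pi^n(\theta)=\mathcal{L}(\theta)d\Pi(\theta)/\int_\Theta\mathcal{L}\,d\Pi$ (Bayes' rule is assumed to be well defined). Note that the skewing distortion depends on $\theta$ through $F_X(\cdot|\theta)$; its derivative in $y$ is $h'_\alpha(y)=2F_X(\alpha F_X^{-1}(y|\theta)|\theta)$, so that the distorted density is $f_X(x|\theta)h'_\alpha(F_X(x|\theta))=2f_X(x|\theta)F_X(\alpha x|\theta)$. The distorted likelihood is $\mathcal{L}_{h_\alpha}(\theta)=\prod_{i=1}^n f_X(x_i|\theta)\,h'_\alpha(F_X(x_i|\theta))$, and the distorted posterior is $\Pi^n_{h_\alpha}(B)=\int_B\mathcal{L}_{h_\alpha}d\Pi/\int_\Theta\mathcal{L}_{h_\alpha}d\Pi$. $\mathrm{Cov}_{\Pi^n}[g(\vartheta),T(\vartheta)]$ for $g$ valued in $\mathbb{R}^s$ and $T$ real-valued is the vector in $\mathbb{R}^s$ of covariances of the components of $g(\vartheta)$ with $T(\vartheta)$,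 for $\vartheta\sim\Pi^n$.
   Formalization: The domination condition is assumed also for g ≡ 1 (so the normalising constant of the distorted posterior can be differentiated), since the claim fails when only the condition for g is assumed; g(ϑ) is taken to have a finite posterior mean. *)

theory Defs
  imports "HOL-Probability.Probability"
begin

text \<open>
  A law on the real line is a measure \<open>N\<close>; its distribution function is the library's
  \<^const>\<open>cdf\<close> and its density is the derivative of that function.
  A parametric model is a map \<open>M\<close> from parameters to laws, and \<open>x 1, ..., x n\<close> is the sample.
\<close>

definition pdf :: "real measure \<Rightarrow> real \<Rightarrow> real" where
  "pdf N t = deriv (cdf N) t"

definition symmetric_law :: "real measure \<Rightarrow> bool" where
  "symmetric_law N \<longleftrightarrow> distr N borel uminus = N"

text \<open>Extended-real valued, so that the quantile is \<open>-\<infinity>\<close> at level 0, and \<open>\<infinity>\<close> at level 1 if the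
  support is unbounded above.\<close>

definition quantile :: "real measure \<Rightarrow> real \<Rightarrow> ereal" where
  "quantile N y = Inf {ereal t | t. y \<le> cdf N t}"

definition skew_distortion :: "real \<Rightarrow> real measure \<Rightarrow> real \<Rightarrow> real" where
  "skew_distortion \<alpha> N y =
     (if \<alpha> = 0 then y
      else (LINT t:{t. ereal t \<le> quantile N y}|lborel. 2 * pdf N t * cdf N (\<alpha> * t)))"

text \<open>Distortion functions live on \<open>[0,1]\<close>; the derivative is one-sided at the endpoints.
  A distortion may depend on the law it is applied to, as the skewing distortion does.\<close>

definition distortion_deriv :: "(real \<Rightarrow> real) \<Rightarrow> real \<Rightarrow> real" where
  "distortion_deriv h y = vector_derivative h (at y within {0..1})"

definition likelihood :: "('p \<Rightarrow> real measure) \<Rightarrow> (nat \<Rightarrow> real) \<Rightarrow> nat \<Rightarrow> 'p \<Rightarrow> real" where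
  "likelihood M x n \<theta> = (\<Prod>i=1..n. pdf (M \<theta>) (x i))"

definition distorted_likelihood ::
  "(real measure \<Rightarrow> real \<Rightarrow> real) \<Rightarrow> ('p \<Rightarrow> real measure) \<Rightarrow> (nat \<Rightarrow> real) \<Rightarrow> nat \<Rightarrow> 'p \<Rightarrow> real" where
  "distorted_likelihood h M x n \<theta> =
     (\<Prod>i=1..n. pdf (M \<theta>) (x i) * distortion_deriv (h (M \<theta>)) (cdf (M \<theta>) (x i)))"

definition posterior :: "'p measure \<Rightarrow> ('p \<Rightarrow> real) \<Rightarrow> 'p measure" where
  "posterior \<pi> L = density \<pi> (\<lambda>\<theta>. ennreal (L \<theta> / (LINT \<theta>'|\<pi>. L \<theta>')))"

definition posterior_mean :: "'p measure \<Rightarrow> ('p \<Rightarrow> real) \<Rightarrow> ('p \<Rightarrow> real ^ 's) \<Rightarrow> real ^ 's" where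
  "posterior_mean \<pi> L g = (LINT \<theta>|posterior \<pi> L. g \<theta>)"

text \<open>Here \<open>L \<alpha>\<close> is the likelihood distorted with parameter \<open>\<alpha>\<close>.\<close>

definition local_sensitivity ::
  "'p measure \<Rightarrow> (real \<Rightarrow> 'p \<Rightarrow> real) \<Rightarrow> ('p \<Rightarrow> real ^ 's) \<Rightarrow> real ^ 's" where
  "local_sensitivity \<pi> L g = vector_derivative (\<lambda>\<alpha>. posterior_mean \<pi> (L \<alpha>) g) (at 0)"

definition dominated_increments ::
  "'p measure \<Rightarrow> (real \<Rightarrow> 'p \<Rightarrow> real) \<Rightarrow> real \<Rightarrow> ('p \<Rightarrow> 'b::real_normed_vector) \<Rightarrow> bool" where
  "dominated_increments \<pi> L \<delta>0 g \<longleftrightarrow>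
     (\<exists>G::'p \<Rightarrow> real. integrable \<pi> G \<and>
        (\<forall>\<delta>. 0 < \<bar>\<delta>\<bar> \<and> \<bar>\<delta>\<bar> \<le> \<delta>0 \<longrightarrow>
           (AE \<theta> in \<pi>. norm (((L \<delta> \<theta> - L 0 \<theta>) / \<delta>) *\<^sub>R g \<theta>) \<le> G \<theta>)))"

definition cov :: "'p measure \<Rightarrow> ('p \<Rightarrow> real) \<Rightarrow> ('p \<Rightarrow> real) \<Rightarrow> real" where
  "cov P S T = (LINT \<theta>|P. (S \<theta> - (LINT \<theta>'|P. S \<theta>')) * (T \<theta> - (LINT \<theta>'|P. T \<theta>')))"

definition cov_vec :: "'p measure \<Rightarrow> ('p \<Rightarrow> real ^ 's) \<Rightarrow> ('p \<Rightarrow> real) \<Rightarrow> real ^ 's" where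
  "cov_vec P g T = (\<chi> j. cov P (\<lambda>\<theta>. g \<theta> $ j) T)"

end

theory Submission
  imports Defs
begin

text \<open>Wherever the density is positive, the distribution function increases strictly, so the quantile
  is continuous at \<open>F\<^sub>X(x|\<theta>)\<close> and \<open>h'\<^sub>\<alpha>(F\<^sub>X(x|\<theta>)) = 2 F\<^sub>X(\<alpha> x|\<theta>)\<close>; where it vanishes, so does
  the factor in the likelihood. Symmetry gives \<open>F\<^sub>X(0|\<theta>) = 1/2\<close>, so the distorted likelihood
  \<open>\<L>(\<theta>) \<Prod>\<^sub>i 2 F\<^sub>X(\<alpha> x\<^sub>i|\<theta>)\<close> has logarithmic derivative \<open>2 f\<^sub>X(0|\<theta>) \<Sum>\<^sub>i x\<^sub>i\<close> at \<open>\<alpha> = 0\<close>. Domination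
  allows differentiation under the integrals in the numerator and denominator of the posterior
  mean, and the quotient rule yields the covariance.\<close>

section \<open>The density of a single law\<close>

text \<open>Writes the density as a limit along one fixed sequence, so that measurability passes
  from difference quotients of the distribution function to the density, both in the point and later
  in the parameter.\<close>

lemma pdf_LIMSEQ:
  assumes "cdf N field_differentiable (at t)"
  shows "(\<lambda>k. (cdf N (t + inverse (real (Suc k))) - cdf N t) / inverse (real (Suc k)))
    \<longlonglongrightarrow> pdf N t"
proof -
  have "((\<lambda>h. (cdf N (t + h) - cdf N t) / h) \<longlongrightarrow> pdf N t) (at 0)"
    using assms by (simp add: pdf_def DERIV_deriv_iff_field_differentiable[symmetric] DERIV_def)
  from this[unfolded tendsto_at_iff_sequentially, rule_format, of "\<lambda>k. inverse (real (Suc k))"]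
  show ?thesis using LIMSEQ_inverse_real_of_nat by (simp add: o_def)
qed

text \<open>Differentiability everywhere makes \<open>pdf\<close> a true derivative rather than a
  default value of \<open>deriv\<close>; \<open>has_pdf\<close> turns Lebesgue integrals weighted by
  it into expectations.\<close>

locale real_distribution_pdf = real_distribution +
  assumes cdf_differentiable: "cdf M field_differentiable (at t)"
    and has_pdf: "M = density lborel (\<lambda>t. ennreal (pdf M t))"
begin

lemma DERIV_cdf: "(cdf M has_real_derivative pdf M t) (at t)"
  using cdf_differentiable by (simp add: pdf_def DERIV_deriv_iff_field_differentiable)

lemma pdf_nonneg: "0 \<le> pdf M t"
  by (rule mono_on_imp_deriv_nonneg[OF _ DERIV_cdf, of UNIV])
    (auto intro: mono_onI cdf_nondecreasing)

lemma isCont_cdf_at: "isCont (cdf M) t"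
  using DERIV_cdf by (rule DERIV_isCont)

lemma borel_measurable_cdf [measurable]: "cdf M \<in> borel_measurable borel"
  by (intro borel_measurable_mono monoI cdf_nondecreasing)

lemma borel_measurable_pdf [measurable]: "pdf M \<in> borel_measurable borel"
  by (rule borel_measurable_LIMSEQ_real[OF pdf_LIMSEQ[OF cdf_differentiable]]) measurable

lemma integral_pdf:
  fixes f :: "real \<Rightarrow> real"
  assumes [measurable]: "f \<in> borel_measurable borel"
  shows "(LINT t|M. f t) = (LINT t|lborel. pdf M t * f t)"
  by (subst has_pdf, subst integral_density) (auto simp: pdf_nonneg)

text \<open>A positive derivative at \<open>x\<close> gives strict increase only close to
  \<open>x\<close>; monotonicity carries it to all points on either side.\<close>

lemma cdf_strict_at:
  assumes "0 < pdf M x"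
  shows "t < x \<Longrightarrow> cdf M t < cdf M x" "x < t \<Longrightarrow> cdf M x < cdf M t"
proof -
  obtain d where d: "d > 0" "\<And>h. h > 0 \<Longrightarrow> h < d \<Longrightarrow> cdf M x < cdf M (x + h)"
    using DERIV_pos_inc_right[OF DERIV_cdf assms] by auto
  obtain e where e: "e > 0" "\<And>h. h > 0 \<Longrightarrow> h < e \<Longrightarrow> cdf M (x - h) < cdf M x"
    using DERIV_pos_inc_left[OF DERIV_cdf assms] by auto
  show "cdf M t < cdf M x" if "t < x"
  proof -
    \<comment> \<open>Halving \<open>e\<close> keeps the step strictly inside the local range, and
      the minimum keeps \<open>x - h\<close> from falling below \<open>t\<close>.\<close>
    define h where "h = min (x - t) (e / 2)"
    have "cdf M t \<le> cdf M (x - h)"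
      by (rule cdf_nondecreasing) (simp add: h_def min_def)
    also have "\<dots> < cdf M x" using that e(1) by (intro e(2)) (auto simp: h_def min_def)
    finally show ?thesis .
  qed
  show "cdf M x < cdf M t" if "x < t"
  proof -
    define h where "h = min (t - x) (d / 2)"
    have "cdf M x < cdf M (x + h)" using that d(1) by (intro d(2)) (auto simp: h_def min_def)
    also have "\<dots> \<le> cdf M t"
      by (rule cdf_nondecreasing) (simp add: h_def min_def)
    finally show ?thesis .
  qed
qed

section \<open>The quantile function and the derivative of the skewing distortion\<close>

text \<open>By the intermediate value theorem the level is attained, so the set defining the
  quantile is nonempty; it is bounded below by \<open>a\<close> and closed by continuity. Its
  infimum is therefore real and belongs to it.\<close>

lemma quantile_between:
  assumes "cdf M a < y" "y < cdf M b"
  obtains r where "quantile M y = ereal r" "a \<le> r" "r \<le> b" "cdf M r = y"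
proof -
  define S where "S = {t. y \<le> cdf M t}"
  have "a \<le> b"
    using assms cdf_nondecreasing[of b a] by linarith
  then obtain r' where r': "r' \<le> b" "cdf M r' = y"
    using IVT[of "cdf M" a y b] assms isCont_cdf_at by force
  have lb: "a \<le> t" if "t \<in> S" for t
    using that assms cdf_nondecreasing[of t a] unfolding S_def by force
  have "r' \<in> S" using r' by (simp add: S_def)
  moreover have "bdd_below S" using lb by (auto simp: bdd_below_def)
  moreover have "closed S"
    unfolding S_def
    by (intro closed_Collect_le continuous_on_const continuous_at_imp_continuous_on ballI isCont_cdf_at)
  ultimately have S: "Inf S \<in> S" "Inf S \<le> r'" "\<And>t. t \<in> S \<Longrightarrow> Inf S \<le> t"
    using closed_contains_Inf[of S] by (auto intro: cInf_lower)
  have "quantile M y = ereal (Inf S)"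
    unfolding quantile_def
    by (rule Inf_eqI) (use S in \<open>auto simp: S_def\<close>)
  \<comment> \<open>Membership of \<open>Inf S\<close> in \<open>S\<close> gives one inequality, and
    \<open>Inf S\<close> lying below the attained point \<open>r'\<close> gives the other.\<close>
  moreover have "cdf M (Inf S) = y"
    using S(1) cdf_nondecreasing[OF S(2)] r'(2) by (auto simp: S_def)
  ultimately show ?thesis
    using that lb S(1,2) r'(1) by force
qed

text \<open>As an expectation under the law itself, the distortion has increments that can be
  compared with interval probabilities, that is, with increments of the level.\<close>

lemma skew_distortion_at_quantile:
  assumes "\<alpha> \<noteq> 0" "quantile M y = ereal r"
  shows "skew_distortion \<alpha> M y = (LINT t|M. indicator {..r} t * (2 * cdf M (\<alpha> * t)))"
proof -
  have "(LINT t|M. indicator {..r} t * (2 * cdf M (\<alpha> * t)))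
      = (LINT t|lborel. pdf M t * (indicator {..r} t * (2 * cdf M (\<alpha> * t))))"
    by (rule integral_pdf) measurable
  also have "\<dots> = skew_distortion \<alpha> M y"
    using assms unfolding skew_distortion_def set_lebesgue_integral_def
    by (auto intro!: Bochner_Integration.integral_cong simp: indicator_def)
  finally show ?thesis ..
qed

text \<open>The difference of the two integrals lives on \<open>{a<..b}\<close>, whose mass is the
  increment of the distribution function, and there the integrand is within \<open>e\<close> of
  \<open>c\<close>.\<close>

lemma integral_atMost_increment:
  fixes \<psi> :: "real \<Rightarrow> real"
  assumes int: "integrable M \<psi>" and "a \<le> b"
    and close: "\<And>t. t \<in> {a..b} \<Longrightarrow> \<bar>\<psi> t - c\<bar> \<le> e"
  shows "\<bar>(LINT t|M. indicator {..b} t * \<psi> t) - (LINT t|M. indicator {..a} t * \<psi> t)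
      - c * (cdf M b - cdf M a)\<bar> \<le> e * (cdf M b - cdf M a)"
proof -
  have meas: "cdf M b - cdf M a = measure M {a<..b}"
    using \<open>a \<le> b\<close> by (cases "a = b") (auto simp: cdf_diff_eq)
  have I: "integrable M (\<lambda>t. indicator {..s} t * \<psi> t)" for s
    using integrable_mult_indicator[OF _ int, of "{..s}"] by simp
  have J: "integrable M (\<lambda>t. indicator {a<..b} t * d)" for d :: real
    by (intro integrable_mult_left integrable_real_indicator) (auto simp: emeasure_eq_measure)
  have m: "(LINT t|M. indicator {a<..b} t * d) = d * measure M {a<..b}" for d :: real
    by simp
  have "(LINT t|M. indicator {..b} t * \<psi> t) - (LINT t|M. indicator {..a} t * \<psi> t)
      - c * (cdf M b - cdf M a)
    = (LINT t|M. indicator {..b} t * \<psi> t - indicator {..a} t * \<psi> t - indicator {a<..b} t * c)"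
    unfolding meas m[symmetric] using I J by simp
  also have "\<bar>\<dots>\<bar> \<le> (LINT t|M. indicator {a<..b} t * e)"
    by (rule order_trans[OF integral_abs_bound integral_mono])
      (use I J close \<open>a \<le> b\<close> in \<open>auto simp: indicator_def\<close>)
  finally show ?thesis unfolding meas m .
qed

lemma integrable_cdf_scaled: "integrable M (\<lambda>t. 2 * cdf M (\<alpha> * t))"
proof (rule integrable_const_bound[where B = 2])
  show "AE t in M. norm (2 * cdf M (\<alpha> * t)) \<le> 2"
    using cdf_bounded_prob cdf_nonneg by auto
qed measurable

text \<open>No continuity of the density is needed: the increment of \<open>h\<^sub>\<alpha>\<close> over a small interval is
  squeezed between multiples of the increment of \<open>y\<close> by the continuity of the distribution function.\<close>

lemma skew_distortion_has_derivative:
  assumes pos: "0 < pdf M x" and "\<alpha> \<noteq> 0"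
  shows "(skew_distortion \<alpha> M has_vector_derivative 2 * cdf M (\<alpha> * x)) (at (cdf M x))"
  unfolding has_vector_derivative_def has_derivative_at_alt
proof (intro conjI allI impI bounded_linear_scaleR_left)
  define \<psi> where "\<psi> t = 2 * cdf M (\<alpha> * t)" for t
  define H where "H r = (LINT t|M. indicator {..r} t * \<psi> t)" for r
  fix e :: real assume "0 < e"
  have "isCont \<psi> x"
    unfolding \<psi>_def
    by (rule isCont_mult[OF continuous_const isCont_o2[OF _ isCont_cdf_at]]) simp
  then obtain d' where d': "d' > 0" "\<And>t. \<bar>t - x\<bar> < d' \<Longrightarrow> \<bar>\<psi> t - \<psi> x\<bar> < e"
    using \<open>0 < e\<close> unfolding continuous_at_eps_delta dist_real_def by blast
  \<comment> \<open>Halving gives the bound on a closed interval, endpoints included.\<close>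
  define d where "d = d' / 2"
  have d: "d > 0" "\<And>t. \<bar>t - x\<bar> \<le> d \<Longrightarrow> \<bar>\<psi> t - \<psi> x\<bar> \<le> e"
    using d' by (auto simp: d_def intro: less_imp_le)
  have strict: "cdf M (x - d) < cdf M x" "cdf M x < cdf M (x + d)"
    using cdf_strict_at[OF pos] d(1) by auto
  have H: "skew_distortion \<alpha> M y = H r" if "quantile M y = ereal r" for y r
    using skew_distortion_at_quantile[OF \<open>\<alpha> \<noteq> 0\<close> that] by (simp add: H_def \<psi>_def)
  have incr: "\<bar>H v - H u - \<psi> x * (cdf M v - cdf M u)\<bar> \<le> e * (cdf M v - cdf M u)"
    if "x - d \<le> u" "u \<le> v" "v \<le> x + d" for u v
    unfolding H_def
    by (rule integral_atMost_increment)
      (use that integrable_cdf_scaled d(2) in \<open>auto simp: \<psi>_def\<close>)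
  obtain r0 where r0: "quantile M (cdf M x) = ereal r0" "cdf M r0 = cdf M x"
    using strict by (rule quantile_between)
  \<comment> \<open>Strict increase at \<open>x\<close> excludes a flat piece there, so the quantile
    inverts the distribution function at this level. At neighbouring levels \<open>r\<close> need
    only satisfy \<open>cdf M r = y\<close>.\<close>
  have "r0 = x"
    using r0(2) cdf_strict_at[OF pos, of r0] by (cases r0 x rule: linorder_cases) auto
  with r0 have H0: "skew_distortion \<alpha> M (cdf M x) = H x" using H by simp
  show "\<exists>\<delta>>0. \<forall>y. norm (y - cdf M x) < \<delta> \<longrightarrow>
      norm (skew_distortion \<alpha> M y - skew_distortion \<alpha> M (cdf M x)
        - (y - cdf M x) *\<^sub>R (2 * cdf M (\<alpha> * x))) \<le> e * norm (y - cdf M x)"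
  proof (intro exI conjI allI impI)
    \<comment> \<open>Levels this close to \<open>cdf M x\<close> lie strictly between the values at
      \<open>x - d\<close> and \<open>x + d\<close>, so their quantiles lie within \<open>d\<close>
      of \<open>x\<close>.\<close>
    let ?\<delta> = "min (cdf M x - cdf M (x - d)) (cdf M (x + d) - cdf M x)"
    show "0 < ?\<delta>" using strict by simp
    fix y assume y: "norm (y - cdf M x) < ?\<delta>"
    then have "cdf M (x - d) < y" "y < cdf M (x + d)" by auto
    then obtain r where r: "quantile M y = ereal r" "x - d \<le> r" "r \<le> x + d" "cdf M r = y"
      by (rule quantile_between)
    have "\<bar>H r - H x - \<psi> x * (y - cdf M x)\<bar> \<le> e * \<bar>y - cdf M x\<bar>"
    proof (cases "x \<le> r")
      case True
      then show ?thesis using incr[of x r] r d(1) cdf_nondecreasing[OF True] by simp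
    next
      case False
      then have "r \<le> x" by simp
      \<comment> \<open>Exchanging the endpoints only changes the sign inside the absolute value, so
        the increment bound also serves levels below \<open>cdf M x\<close>.\<close>
      have "\<bar>H x - H r - \<psi> x * (cdf M x - y)\<bar> = \<bar>H r - H x - \<psi> x * (y - cdf M x)\<bar>"
        by (simp add: algebra_simps abs_if)
      then show ?thesis using \<open>r \<le> x\<close> incr[of r x] r d(1) cdf_nondecreasing[OF \<open>r \<le> x\<close>] by simp
    qed
    then show "norm (skew_distortion \<alpha> M y - skew_distortion \<alpha> M (cdf M x)
        - (y - cdf M x) *\<^sub>R (2 * cdf M (\<alpha> * x))) \<le> e * norm (y - cdf M x)"
      by (simp add: H[OF r(1)] H0 \<psi>_def mult.commute)
  qed
qed

section \<open>Symmetry and the distorted density\<close>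

text \<open>Reflection gives the two closed half-lines equal mass. They overlap only in the origin,
  which is null by continuity, so each has mass one half.\<close>

lemma cdf_at_0:
  assumes "symmetric_law M"
  shows "cdf M 0 = 1 / 2"
proof -
  have "prob {..0} = measure (distr M borel uminus) {..0}"
    using assms by (simp add: symmetric_law_def)
  also have "\<dots> = prob {0..}"
    by (subst measure_distr) (auto intro!: arg_cong[where f = prob])
  finally have "prob {..0} = prob {0..}" .
  moreover have "prob {0..} = prob {0} + prob {0<..}"
    by (subst finite_measure_Union[symmetric]) (auto intro!: arg_cong[where f = prob])
  moreover have "prob {0<..} = 1 - prob {..0}"
    using prob_compl[of "{..0}"] by (auto simp: Compl_eq_Diff_UNIV[symmetric])
  ultimately show ?thesis
    using isCont_cdf[of 0] isCont_cdf_at by (simp add: cdf_def)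
qed

text \<open>Keeping the factor \<open>pdf M x\<close> on both sides settles points of zero density,
  where the derivative of the distortion is not controlled. At \<alpha> = 0 the distortion is the
  identity, and symmetry makes its derivative 1 agree with the general formula.\<close>

lemma distorted_pdf:
  assumes "symmetric_law M"
  shows "pdf M x * distortion_deriv (skew_distortion \<alpha> M) (cdf M x) = pdf M x * (2 * cdf M (\<alpha> * x))"
proof (cases "pdf M x = 0")
  case False
  then have pos: "0 < pdf M x" using pdf_nonneg[of x] by simp
  have D: "(skew_distortion \<alpha> M has_vector_derivative 2 * cdf M (\<alpha> * x)) (at (cdf M x))"
  proof (cases "\<alpha> = 0")
    case True
    then have "skew_distortion \<alpha> M = (\<lambda>y. y)" by (auto simp: skew_distortion_def)
    then show ?thesis using True cdf_at_0[OF assms] by (simp only: mult_zero_left) simp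
  qed (rule skew_distortion_has_derivative[OF pos])
  \<comment> \<open>The two-sided derivative restricts to \<open>{0..1}\<close>, where derivatives
    within the interval are unique.\<close>
  have "distortion_deriv (skew_distortion \<alpha> M) (cdf M x) = 2 * cdf M (\<alpha> * x)"
    unfolding distortion_deriv_def
    by (rule vector_derivative_within_closed_interval)
      (auto intro: has_vector_derivative_at_within D simp: cdf_nonneg cdf_bounded_prob)
  then show ?thesis by simp
qed simp

end

section \<open>Differentiation under the integral\<close>

text \<open>Puts vector derivatives into difference quotient form, the form in which dominated
  convergence along sequences applies.\<close>

lemma has_vector_derivative_at_iff_LIM:
  "(f has_vector_derivative D) (at x) \<longleftrightarrow> ((\<lambda>h. (f (x + h) - f x) /\<^sub>R h) \<longlongrightarrow> D) (at 0)"
proof -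
  have "norm (f (x + h) - f x - h *\<^sub>R D) / norm h = norm ((f (x + h) - f x) /\<^sub>R h - D)" if "h \<noteq> 0" for h
  proof -
    have "(f (x + h) - f x) /\<^sub>R h - D = (f (x + h) - f x - h *\<^sub>R D) /\<^sub>R h"
      using that by (simp add: scaleR_diff_right)
    then show ?thesis by (simp add: divide_inverse mult.commute)
  qed
  then have "((\<lambda>h. norm (f (x + h) - f x - h *\<^sub>R D) / norm h) \<longlongrightarrow> 0) (at 0)
      \<longleftrightarrow> ((\<lambda>h. norm ((f (x + h) - f x) /\<^sub>R h - D)) \<longlongrightarrow> 0) (at 0)"
    by (intro Lim_cong_within) auto
  also have "\<dots> \<longleftrightarrow> ((\<lambda>h. (f (x + h) - f x) /\<^sub>R h) \<longlongrightarrow> D) (at 0)"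
    by (simp only: tendsto_norm_zero_iff LIM_zero_iff)
  finally show ?thesis
    by (simp add: has_vector_derivative_def has_derivative_at bounded_linear_scaleR_left)
qed

text \<open>The exceptional null set in the domination may depend on \<delta>. Dominated convergence
  along a sequence tolerates this, and sequences suffice for the limit at 0.\<close>

lemma dominated_increments_has_vector_derivative:
  fixes L :: "real \<Rightarrow> 'p \<Rightarrow> real" and g :: "'p \<Rightarrow> 'b::{banach, second_countable_topology}"
  assumes [measurable]: "\<And>\<delta>. L \<delta> \<in> borel_measurable \<pi>" "g \<in> borel_measurable \<pi>"
      "L' \<in> borel_measurable \<pi>"
    and int0: "integrable \<pi> (\<lambda>\<theta>. L 0 \<theta> *\<^sub>R g \<theta>)"
    and dom: "dominated_increments \<pi> L \<delta>0 g" and "0 < \<delta>0"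
    and deriv: "\<And>\<theta>. \<theta> \<in> space \<pi> \<Longrightarrow> ((\<lambda>\<delta>. L \<delta> \<theta>) has_real_derivative L' \<theta>) (at 0)"
  shows "integrable \<pi> (\<lambda>\<theta>. L' \<theta> *\<^sub>R g \<theta>)" (is ?int)
    and "((\<lambda>\<delta>. LINT \<theta>|\<pi>. L \<delta> \<theta> *\<^sub>R g \<theta>) has_vector_derivative (LINT \<theta>|\<pi>. L' \<theta> *\<^sub>R g \<theta>)) (at 0)"
      (is ?deriv)
proof -
  define q where "q \<delta> \<theta> = ((L \<delta> \<theta> - L 0 \<theta>) / \<delta>) *\<^sub>R g \<theta>" for \<delta> \<theta>
  have [measurable]: "q \<delta> \<in> borel_measurable \<pi>" for \<delta> unfolding q_def by measurable
  obtain G where G: "integrable \<pi> G"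
    "\<And>\<delta>. 0 < \<bar>\<delta>\<bar> \<Longrightarrow> \<bar>\<delta>\<bar> \<le> \<delta>0 \<Longrightarrow> AE \<theta> in \<pi>. norm (q \<delta> \<theta>) \<le> G \<theta>"
    using dom unfolding dominated_increments_def q_def by blast
  have int_q: "integrable \<pi> (q \<delta>)" if "0 < \<bar>\<delta>\<bar>" "\<bar>\<delta>\<bar> \<le> \<delta>0" for \<delta>
  proof (rule Bochner_Integration.integrable_bound[OF G(1)])
    show "AE \<theta> in \<pi>. norm (q \<delta> \<theta>) \<le> norm (G \<theta>)" using G(2)[OF that] by eventually_elim simp
  qed measurable
  \<comment> \<open>Integrability at \<delta> is not assumed: it follows by adding
    \<open>\<delta> *\<^sub>R q \<delta>\<close> to the integrable function at 0.\<close>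
  have q_quotient: "(LINT \<theta>|\<pi>. q \<delta> \<theta>) = ((LINT \<theta>|\<pi>. L \<delta> \<theta> *\<^sub>R g \<theta>) - (LINT \<theta>|\<pi>. L 0 \<theta> *\<^sub>R g \<theta>)) /\<^sub>R \<delta>"
    if \<delta>: "0 < \<bar>\<delta>\<bar>" "\<bar>\<delta>\<bar> \<le> \<delta>0" for \<delta>
  proof -
    have "L \<delta> \<theta> *\<^sub>R g \<theta> = L 0 \<theta> *\<^sub>R g \<theta> + \<delta> *\<^sub>R q \<delta> \<theta>" for \<theta>
      using \<delta>(1) by (simp add: q_def flip: scaleR_add_left)
    then have "(LINT \<theta>|\<pi>. L \<delta> \<theta> *\<^sub>R g \<theta>) = (LINT \<theta>|\<pi>. L 0 \<theta> *\<^sub>R g \<theta>) + \<delta> *\<^sub>R (LINT \<theta>|\<pi>. q \<delta> \<theta>)"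
      using int0 int_q[OF \<delta>] by simp
    then show ?thesis using \<delta>(1) by simp
  qed
  have lim: "?int \<and> (\<lambda>i. LINT \<theta>|\<pi>. q (Y i) \<theta>) \<longlonglongrightarrow> (LINT \<theta>|\<pi>. L' \<theta> *\<^sub>R g \<theta>)"
    if Y: "\<And>i. Y i \<noteq> 0" "\<And>i. \<bar>Y i\<bar> \<le> \<delta>0" "Y \<longlonglongrightarrow> 0" for Y :: "nat \<Rightarrow> real"
  proof -
    have lim: "AE \<theta> in \<pi>. (\<lambda>i. q (Y i) \<theta>) \<longlonglongrightarrow> L' \<theta> *\<^sub>R g \<theta>"
    proof (rule AE_I2)
      fix \<theta> assume "\<theta> \<in> space \<pi>"
      from deriv[OF this] have "((\<lambda>h. (L h \<theta> - L 0 \<theta>) / h) \<longlongrightarrow> L' \<theta>) (at 0)"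
        by (simp add: DERIV_def)
      then have "(\<lambda>i. (L (Y i) \<theta> - L 0 \<theta>) / Y i) \<longlonglongrightarrow> L' \<theta>"
        unfolding tendsto_at_iff_sequentially using Y by (auto simp: o_def)
      then show "(\<lambda>i. q (Y i) \<theta>) \<longlonglongrightarrow> L' \<theta> *\<^sub>R g \<theta>"
        unfolding q_def by (intro tendsto_intros)
    qed
    have bound: "AE \<theta> in \<pi>. norm (q (Y i) \<theta>) \<le> G \<theta>" for i
      using G(2) Y by simp
    show ?thesis
      using integrable_dominated_convergence[OF _ _ G(1) lim bound]
        integral_dominated_convergence[OF _ _ G(1) lim bound] by simp
  qed
  \<comment> \<open>Any admissible null sequence yields the integrability of the limit; this one
    stays nonzero and within \<delta>0.\<close>
  have "(\<lambda>i. \<delta>0 * inverse (real (Suc i))) \<longlonglongrightarrow> \<delta>0 * 0"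
    by (intro tendsto_mult tendsto_const LIMSEQ_inverse_real_of_nat)
  then show ?int
    using \<open>0 < \<delta>0\<close> lim[of "\<lambda>i. \<delta>0 * inverse (real (Suc i))"] by (simp add: field_simps)
  show ?deriv
    unfolding has_vector_derivative_at_iff_LIM tendsto_at_iff_sequentially
  proof (intro allI impI)
    fix X :: "nat \<Rightarrow> real"
    assume X: "\<forall>i. X i \<in> UNIV - {0}" "X \<longlonglongrightarrow> 0"
    \<comment> \<open>An arbitrary null sequence may start outside the dominated range. Replacing
      those terms by \<delta>0 keeps every term admissible and changes only finitely many.\<close>
    define Y where "Y i = (if \<bar>X i\<bar> \<le> \<delta>0 then X i else \<delta>0)" for i
    have "\<forall>\<^sub>F i in sequentially. \<bar>X i\<bar> < \<delta>0"
      using order_tendstoD(2)[OF tendsto_rabs_zero[OF X(2)] \<open>0 < \<delta>0\<close>] .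
    then have ev: "\<forall>\<^sub>F i in sequentially. X i = Y i"
      by eventually_elim (simp add: Y_def)
    have "Y i \<noteq> 0" "\<bar>Y i\<bar> \<le> \<delta>0" for i using X(1) \<open>0 < \<delta>0\<close> by (auto simp: Y_def)
    moreover have "Y \<longlonglongrightarrow> 0" using X(2) ev by (rule Lim_transform_eventually)
    ultimately have "(\<lambda>i. LINT \<theta>|\<pi>. q (Y i) \<theta>) \<longlonglongrightarrow> (LINT \<theta>|\<pi>. L' \<theta> *\<^sub>R g \<theta>)"
      using lim by blast
    moreover have "\<forall>\<^sub>F i in sequentially. (LINT \<theta>|\<pi>. q (Y i) \<theta>) =
      ((\<lambda>h. ((LINT \<theta>|\<pi>. L (0 + h) \<theta> *\<^sub>R g \<theta>) - (LINT \<theta>|\<pi>. L 0 \<theta> *\<^sub>R g \<theta>)) /\<^sub>R h) \<circ> X) i"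
      using ev
    proof eventually_elim
      case (elim i)
      then show ?case
        using q_quotient[of "X i"] \<open>Y i \<noteq> 0\<close> \<open>\<bar>Y i\<bar> \<le> \<delta>0\<close> by simp
    qed
    ultimately show "((\<lambda>h. ((LINT \<theta>|\<pi>. L (0 + h) \<theta> *\<^sub>R g \<theta>) - (LINT \<theta>|\<pi>. L 0 \<theta> *\<^sub>R g \<theta>)) /\<^sub>R h) \<circ> X)
        \<longlonglongrightarrow> (LINT \<theta>|\<pi>. L' \<theta> *\<^sub>R g \<theta>)"
      by (rule Lim_transform_eventually)
  qed
qed

section \<open>Posterior means, posterior covariance and sensitivity\<close>

lemma
  fixes g :: "'p \<Rightarrow> 'b::{banach, second_countable_topology}"
  assumes [measurable]: "L \<in> borel_measurable \<pi>" "g \<in> borel_measurable \<pi>"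
    and nonneg: "\<And>\<theta>. \<theta> \<in> space \<pi> \<Longrightarrow> 0 \<le> L \<theta>"
  shows integral_posterior:
      "(LINT \<theta>|posterior \<pi> L. g \<theta>) = (LINT \<theta>|\<pi>. L \<theta> *\<^sub>R g \<theta>) /\<^sub>R (LINT \<theta>|\<pi>. L \<theta>)"
    and integrable_posterior_iff: "(LINT \<theta>|\<pi>. L \<theta>) \<noteq> 0 \<Longrightarrow>
      integrable (posterior \<pi> L) g \<longleftrightarrow> integrable \<pi> (\<lambda>\<theta>. L \<theta> *\<^sub>R g \<theta>)"
proof -
  define c where "c = (LINT \<theta>|\<pi>. L \<theta>)"
  have "0 \<le> c" unfolding c_def by (rule Bochner_Integration.integral_nonneg) (rule nonneg)
  then have nn: "AE \<theta> in \<pi>. 0 \<le> L \<theta> / c" using nonneg by (auto intro!: AE_I2)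
  have eq: "(L \<theta> / c) *\<^sub>R g \<theta> = inverse c *\<^sub>R (L \<theta> *\<^sub>R g \<theta>)" for \<theta>
    by (simp add: divide_inverse mult.commute)
  show "(LINT \<theta>|posterior \<pi> L. g \<theta>) = (LINT \<theta>|\<pi>. L \<theta> *\<^sub>R g \<theta>) /\<^sub>R (LINT \<theta>|\<pi>. L \<theta>)"
    unfolding posterior_def c_def[symmetric]
    by (subst integral_density[OF _ _ nn]) (simp_all add: eq del: scaleR_scaleR)
  assume "(LINT \<theta>|\<pi>. L \<theta>) \<noteq> 0"
  then have "c \<noteq> 0" by (simp add: c_def)
  then have "integrable \<pi> (\<lambda>\<theta>. inverse c *\<^sub>R (L \<theta> *\<^sub>R g \<theta>))
      \<longleftrightarrow> integrable \<pi> (\<lambda>\<theta>. L \<theta> *\<^sub>R g \<theta>)"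
    using integrable_scaleR_right[of c \<pi> "\<lambda>\<theta>. inverse c *\<^sub>R (L \<theta> *\<^sub>R g \<theta>)"]
      integrable_scaleR_right[of "inverse c" \<pi> "\<lambda>\<theta>. L \<theta> *\<^sub>R g \<theta>"]
    by (auto simp: mult.assoc[symmetric])
  then show "integrable (posterior \<pi> L) g \<longleftrightarrow> integrable \<pi> (\<lambda>\<theta>. L \<theta> *\<^sub>R g \<theta>)"
    unfolding posterior_def c_def[symmetric]
    by (subst integrable_density[OF _ _ nn]) (simp_all add: eq del: scaleR_scaleR)
qed

lemma prob_space_posterior:
  assumes int: "integrable \<pi> L" and nonneg: "\<And>\<theta>. \<theta> \<in> space \<pi> \<Longrightarrow> 0 \<le> L \<theta>"
    and pos: "0 < (LINT \<theta>|\<pi>. L \<theta>)"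
  shows "prob_space (posterior \<pi> L)"
proof (rule prob_spaceI)
  have [measurable]: "L \<in> borel_measurable \<pi>" using int by (rule borel_measurable_integrable)
  have "emeasure (posterior \<pi> L) (space (posterior \<pi> L))
      = (\<integral>\<^sup>+\<theta>. ennreal (L \<theta> / (LINT \<theta>|\<pi>. L \<theta>)) \<partial>\<pi>)"
    unfolding posterior_def by (simp add: emeasure_density cong: nn_integral_cong)
  also have "\<dots> = ennreal (LINT \<theta>|\<pi>. L \<theta> / (LINT \<theta>|\<pi>. L \<theta>))"
    using int nonneg pos by (intro nn_integral_eq_integral) auto
  also have "\<dots> = 1" using pos by simp
  finally show "emeasure (posterior \<pi> L) (space (posterior \<pi> L)) = 1" .
qed

lemma (in prob_space) cov_eq:
  assumes S: "integrable M S" and T: "integrable M T" and ST: "integrable M (\<lambda>\<theta>. T \<theta> * S \<theta>)"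
  shows "cov M S T = expectation (\<lambda>\<theta>. T \<theta> * S \<theta>) - expectation T * expectation S"
proof -
  have "(S \<theta> - s) * (T \<theta> - t) = T \<theta> * S \<theta> - s * T \<theta> - t * S \<theta> + s * t" for \<theta> s t
    by (simp add: algebra_simps)
  then show ?thesis
    unfolding cov_def using S T ST by (simp add: prob_space)
qed

text \<open>Coordinate projections are bounded linear and so commute with the integral, which
  reduces the claim to the scalar case.\<close>

lemma (in prob_space) cov_vec_eq:
  fixes g :: "'a \<Rightarrow> real ^ 's"
  assumes g: "integrable M g" and T: "integrable M T" and Tg: "integrable M (\<lambda>\<theta>. T \<theta> *\<^sub>R g \<theta>)"
  shows "cov_vec M g T = expectation (\<lambda>\<theta>. T \<theta> *\<^sub>R g \<theta>) - expectation T *\<^sub>R expectation g"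
proof (rule vec_eq_iff[THEN iffD2, rule_format])
  fix j
  note nth = integrable_bounded_linear[OF bounded_linear_vec_nth[of j]]
    integral_bounded_linear[OF bounded_linear_vec_nth[of j]]
  have "cov M (\<lambda>\<theta>. g \<theta> $ j) T
      = expectation (\<lambda>\<theta>. T \<theta> * g \<theta> $ j) - expectation T * expectation (\<lambda>\<theta>. g \<theta> $ j)"
    using nth(1)[OF g] T nth(1)[OF Tg] by (intro cov_eq) auto
  then show "cov_vec M g T $ j
      = (expectation (\<lambda>\<theta>. T \<theta> *\<^sub>R g \<theta>) - expectation T *\<^sub>R expectation g) $ j"
    using nth(2)[OF g] nth(2)[OF Tg] by (simp add: cov_vec_def)
qed

text \<open>Here \<open>T\<close> is the score, the logarithmic derivative of the likelihood at 0
  where that likelihood is positive. \<open>dom_g\<close> serves the numerator of the posterior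
  mean, \<open>dom_1\<close> its normalising constant.\<close>

lemma posterior_sensitivity:
  fixes L :: "real \<Rightarrow> 'p \<Rightarrow> real" and g :: "'p \<Rightarrow> real ^ 's"
  assumes [measurable]: "\<And>\<delta>. L \<delta> \<in> borel_measurable \<pi>" "g \<in> borel_measurable \<pi>"
      "T \<in> borel_measurable \<pi>"
    and nonneg: "\<And>\<delta> \<theta>. \<theta> \<in> space \<pi> \<Longrightarrow> 0 \<le> L \<delta> \<theta>"
    and int0: "integrable \<pi> (L 0)" and pos: "0 < (LINT \<theta>|\<pi>. L 0 \<theta>)"
    and g: "integrable (posterior \<pi> (L 0)) g"
    and "0 < \<delta>0"
    and dom_g: "dominated_increments \<pi> L \<delta>0 g"
    and dom_1: "dominated_increments \<pi> L \<delta>0 (\<lambda>_. 1 :: real)"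
    and deriv: "\<And>\<theta>. \<theta> \<in> space \<pi> \<Longrightarrow> ((\<lambda>\<delta>. L \<delta> \<theta>) has_real_derivative L 0 \<theta> * T \<theta>) (at 0)"
  shows "integrable (posterior \<pi> (L 0)) T"
    and "integrable (posterior \<pi> (L 0)) (\<lambda>\<theta>. T \<theta> *\<^sub>R g \<theta>)"
    and "((\<lambda>\<delta>. posterior_mean \<pi> (L \<delta>) g) has_vector_derivative cov_vec (posterior \<pi> (L 0)) g T) (at 0)"
proof -
  define c where "c = (LINT \<theta>|\<pi>. L 0 \<theta>)"
  define m where "m = (LINT \<theta>|\<pi>. L 0 \<theta> *\<^sub>R g \<theta>)"
  define c' where "c' = (LINT \<theta>|\<pi>. L 0 \<theta> * T \<theta>)"
  define m' where "m' = (LINT \<theta>|\<pi>. (L 0 \<theta> * T \<theta>) *\<^sub>R g \<theta>)"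
  let ?P = "posterior \<pi> (L 0)"
  interpret P: prob_space ?P using int0 nonneg pos by (rule prob_space_posterior)
  have "c \<noteq> 0" using pos by (simp add: c_def)
  have g0: "integrable \<pi> (\<lambda>\<theta>. L 0 \<theta> *\<^sub>R g \<theta>)"
    using g pos nonneg by (subst (asm) integrable_posterior_iff) auto
  have LT: "integrable \<pi> (\<lambda>\<theta>. L 0 \<theta> * T \<theta>)"
    and dc: "((\<lambda>\<delta>. LINT \<theta>|\<pi>. L \<delta> \<theta>) has_vector_derivative c') (at 0)"
    using dominated_increments_has_vector_derivative[OF _ _ _ _ dom_1 \<open>0 < \<delta>0\<close> deriv] int0
    by (simp_all add: c'_def)
  have LTg: "integrable \<pi> (\<lambda>\<theta>. (L 0 \<theta> * T \<theta>) *\<^sub>R g \<theta>)"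
    and dm: "((\<lambda>\<delta>. LINT \<theta>|\<pi>. L \<delta> \<theta> *\<^sub>R g \<theta>) has_vector_derivative m') (at 0)"
    using dominated_increments_has_vector_derivative[OF _ _ _ g0 dom_g \<open>0 < \<delta>0\<close> deriv]
    by (simp_all add: m'_def)
  show T: "integrable ?P T"
    using LT pos nonneg by (subst integrable_posterior_iff) auto
  show Tg: "integrable ?P (\<lambda>\<theta>. T \<theta> *\<^sub>R g \<theta>)"
    using LTg pos nonneg by (subst integrable_posterior_iff) auto
  have ET: "P.expectation T = c' / c"
    using nonneg by (subst integral_posterior) (auto simp: c_def c'_def divide_inverse mult.commute)
  have Eg: "P.expectation g = m /\<^sub>R c"
    using nonneg by (subst integral_posterior) (auto simp: c_def m_def)
  have ETg: "P.expectation (\<lambda>\<theta>. T \<theta> *\<^sub>R g \<theta>) = m' /\<^sub>R c"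
    using nonneg by (subst integral_posterior) (auto simp: c_def m'_def)
  \<comment> \<open>This holds for every \<delta>, even if the normalising integral is 0: division
    by zero then makes both sides 0.\<close>
  have mean: "posterior_mean \<pi> (L \<delta>) g
      = inverse (LINT \<theta>|\<pi>. L \<delta> \<theta>) *\<^sub>R (LINT \<theta>|\<pi>. L \<delta> \<theta> *\<^sub>R g \<theta>)" for \<delta>
    unfolding posterior_mean_def using nonneg by (subst integral_posterior) auto
  have "((\<lambda>\<delta>. inverse (LINT \<theta>|\<pi>. L \<delta> \<theta>)) has_real_derivative - (inverse c * c' * inverse c)) (at 0)"
    using dc \<open>c \<noteq> 0\<close> unfolding c_def
    by (intro DERIV_inverse') (auto simp: has_real_derivative_iff_has_vector_derivative)
  from has_vector_derivative_scaleR[OF this dm]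
  have "((\<lambda>\<delta>. posterior_mean \<pi> (L \<delta>) g) has_vector_derivative
      (inverse c *\<^sub>R m' + (- (inverse c * c' * inverse c)) *\<^sub>R m)) (at 0)"
    unfolding mean c_def[symmetric] m_def[symmetric] .
  \<comment> \<open>The quotient rule gives \<open>m'/c - (c'/c)(m/c)\<close>, which is the mean of
    the product minus the product of the means under the posterior.\<close>
  also have "inverse c *\<^sub>R m' + (- (inverse c * c' * inverse c)) *\<^sub>R m = cov_vec ?P g T"
    unfolding P.cov_vec_eq[OF g T Tg] ET Eg ETg by (simp add: divide_inverse mult_ac)
  finally show "((\<lambda>\<delta>. posterior_mean \<pi> (L \<delta>) g) has_vector_derivative cov_vec ?P g T) (at 0)" .
qed

section \<open>The skewed likelihood of the parametric model\<close>

theorem proposition6: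
  fixes \<Theta> :: "(real ^ 'k) set"
    and \<pi> :: "(real ^ 'k) measure"
    and M :: "real ^ 'k \<Rightarrow> real measure"
    and x :: "nat \<Rightarrow> real" and n :: nat
    and g :: "real ^ 'k \<Rightarrow> real ^ 's"
    and \<delta>0 :: real
  assumes prior: "prob_space \<pi>" "sets \<pi> = sets (restrict_space borel \<Theta>)"
    and model: "M \<in> \<pi> \<rightarrow>\<^sub>M prob_algebra borel"
    and cdf_differentiable: "\<forall>\<theta>\<in>\<Theta>. \<forall>t. cdf (M \<theta>) field_differentiable (at t)"
    and has_density: "\<forall>\<theta>\<in>\<Theta>. M \<theta> = density lborel (\<lambda>t. ennreal (pdf (M \<theta>) t))"
    and symmetric: "\<forall>\<theta>\<in>\<Theta>. symmetric_law (M \<theta>)"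
    and bayes_well_defined: "integrable \<pi> (likelihood M x n)"
      "0 < (LINT \<theta>|\<pi>. likelihood M x n \<theta>)"
    and log_differentiable: "AE \<theta> in \<pi>. \<forall>i\<in>{1..n}.
      (\<lambda>\<alpha>. ln (distortion_deriv (skew_distortion \<alpha> (M \<theta>)) (cdf (M \<theta>) (x i))))
        field_differentiable (at 0)"
    and delta0: "0 < \<delta>0"
    and g_measurable: "g \<in> borel_measurable \<pi>"
    and g_integrable: "integrable (posterior \<pi> (likelihood M x n)) g"
    and dominated_g:
      "dominated_increments \<pi> (\<lambda>\<alpha>. distorted_likelihood (skew_distortion \<alpha>) M x n) \<delta>0 g"
    and dominated_1:
      "dominated_increments \<pi> (\<lambda>\<alpha>. distorted_likelihood (skew_distortion \<alpha>) M x n) \<delta>0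
         (\<lambda>_. 1 :: real)"
  shows "let L = (\<lambda>\<alpha>. distorted_likelihood (skew_distortion \<alpha>) M x n);
             P = posterior \<pi> (likelihood M x n);
             T = (\<lambda>\<theta>. 2 * pdf (M \<theta>) 0 * (\<Sum>i=1..n. x i))
         in integrable P T \<and> integrable P (\<lambda>\<theta>. T \<theta> *\<^sub>R g \<theta>) \<and>
            (\<lambda>\<alpha>. posterior_mean \<pi> (L \<alpha>) g) differentiable (at 0) \<and>
            local_sensitivity \<pi> L g = cov_vec P g T"
proof -
  define L where "L \<alpha> = distorted_likelihood (skew_distortion \<alpha>) M x n" for \<alpha>
  define T where "T \<theta> = 2 * pdf (M \<theta>) 0 * (\<Sum>i=1..n. x i)" for \<theta>
  have space: "space \<pi> = \<Theta>"
    using sets_eq_imp_space_eq[OF prior(2)] by (simp add: space_restrict_space)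
  have law: "real_distribution_pdf (M \<theta>)" if "\<theta> \<in> space \<pi>" for \<theta>
    using measurable_space[OF model that] that cdf_differentiable has_density
    by (auto simp: space space_prob_algebra real_distribution_pdf_def real_distribution_def
        real_distribution_axioms_def real_distribution_pdf_axioms_def)
  have sym: "symmetric_law (M \<theta>)" if "\<theta> \<in> space \<pi>" for \<theta>
    using that symmetric by (simp add: space)
  have [measurable]: "(\<lambda>\<theta>. cdf (M \<theta>) t) \<in> borel_measurable \<pi>" for t
    unfolding cdf_def by (rule measurable_compose[OF model measurable_measure_prob_algebra]) simp
  \<comment> \<open>For fixed \<open>t\<close> the density is a pointwise limit of difference
    quotients of \<open>cdf (M \<theta>)\<close>, each measurable in \<theta>.\<close>
  have [measurable]: "(\<lambda>\<theta>. pdf (M \<theta>) t) \<in> borel_measurable \<pi>" for t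
    by (rule borel_measurable_LIMSEQ_real[OF pdf_LIMSEQ])
      (use cdf_differentiable in \<open>auto simp: space\<close>)
  have L_eq: "L \<alpha> \<theta> = likelihood M x n \<theta> * (\<Prod>i=1..n. 2 * cdf (M \<theta>) (\<alpha> * x i))"
    if "\<theta> \<in> space \<pi>" for \<alpha> \<theta>
    unfolding L_def distorted_likelihood_def likelihood_def prod.distrib[symmetric]
    by (intro prod.cong refl real_distribution_pdf.distorted_pdf[OF law[OF that] sym[OF that]])
  have half: "cdf (M \<theta>) 0 = 1 / 2" if "\<theta> \<in> space \<pi>" for \<theta>
    using law[OF that] sym[OF that] by (rule real_distribution_pdf.cdf_at_0)
  have L0: "L 0 \<theta> = likelihood M x n \<theta>" if "\<theta> \<in> space \<pi>" for \<theta>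
    using that by (simp add: L_eq half)
  have measL [measurable]: "L \<alpha> \<in> borel_measurable \<pi>" for \<alpha>
    by (subst measurable_cong[OF L_eq]) (auto simp: likelihood_def)
  have measT: "T \<in> borel_measurable \<pi>" unfolding T_def by measurable
  have nonneg: "0 \<le> L \<alpha> \<theta>" if "\<theta> \<in> space \<pi>" for \<alpha> \<theta>
  proof -
    interpret real_distribution_pdf "M \<theta>" using that by (rule law)
    show ?thesis
      unfolding L_eq[OF that] likelihood_def
      by (intro mult_nonneg_nonneg prod_nonneg ballI pdf_nonneg cdf_nonneg) simp
  qed
  have deriv: "((\<lambda>\<alpha>. L \<alpha> \<theta>) has_real_derivative L 0 \<theta> * T \<theta>) (at 0)" if "\<theta> \<in> space \<pi>" for \<theta>
  proof -
    interpret real_distribution_pdf "M \<theta>" using that by (rule law)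
    have "((\<lambda>\<alpha>. 2 * cdf (M \<theta>) (\<alpha> * x i)) has_real_derivative 2 * (pdf (M \<theta>) 0 * x i)) (at 0)" for i
      by (intro DERIV_cmult DERIV_chain2[where f = "cdf (M \<theta>)"])
        (auto simp: DERIV_cdf intro!: derivative_eq_intros)
    \<comment> \<open>The logarithmic form of the product rule needs nonzero factors; at \<alpha> =
      0 each factor equals 1 by \<open>half\<close>, so the sum of quotients becomes the score
      \<open>T\<close>.\<close>
    then have "((\<lambda>\<alpha>. \<Prod>i=1..n. 2 * cdf (M \<theta>) (\<alpha> * x i)) has_real_derivative
        (\<Prod>i=1..n. 2 * cdf (M \<theta>) (0 * x i))
        * (\<Sum>i=1..n. 2 * (pdf (M \<theta>) 0 * x i) / (2 * cdf (M \<theta>) (0 * x i)))) (at 0)"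
      using half[OF that] by (intro has_field_derivative_prod') auto
    from DERIV_cmult[OF this, of "likelihood M x n \<theta>"] show ?thesis
      using that by (simp add: L_eq half T_def sum_distrib_left mult.assoc)
  qed
  \<comment> \<open>\<open>L 0\<close> and the undistorted likelihood are known to agree only on the
    parameter space, which is enough for the densities to define the same posterior.\<close>
  have P: "posterior \<pi> (L 0) = posterior \<pi> (likelihood M x n)"
    unfolding posterior_def
    using L0 bayes_well_defined(1)
    by (intro density_cong AE_I2) (auto cong: Bochner_Integration.integral_cong)
  have int0: "integrable \<pi> (L 0)" and pos0: "0 < (LINT \<theta>|\<pi>. L 0 \<theta>)"
    using bayes_well_defined L0
    by (auto cong: Bochner_Integration.integrable_cong Bochner_Integration.integral_cong)
  note sensitivity = posterior_sensitivity[where L = L, OF measL g_measurable measT nonneg int0 pos0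
      g_integrable[folded P] delta0 dominated_g[folded L_def] dominated_1[folded L_def] deriv,
      unfolded P]
  show ?thesis
    using sensitivity differentiableI_vector[OF sensitivity(3)]
      vector_derivative_at[OF sensitivity(3)]
    unfolding Let_def local_sensitivity_def L_def T_def by simp
qed

end
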